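(* Let $G$ be a graph. (1) If $G+v$ is a graph obtained from $G$ by adding a new vertex $v$ and joining it to at least one vertex of $G$, then $2\leq mp(G+v)\leq |V(G)|+1$. (2) If $|V(G)|\geq 2$ and $v\in V(G)$, then $1\leq mp(G-v)\leq |V(G)|-1$.
   Context: All graphs are finite, simple, undirected, with non-empty vertex set. A path $v_1v_2\ldots v_k$ (distinct vertices, consecutive ones adjacent, $k\ge 1$) in a graph $G$ is degree monotone if $\deg(v_1)\le \deg(v_2)\le\dots\le\deg(v_k)$ or $\deg(v_1)\ge\deg(v_2)\ge\dots\ge\deg(v_k)$, where degrees are taken in $G$. The length of a degree monotone path is its number of vertices, and $mp(G)$ is the maximum length of a degree monotone path in $G$. $G-v$ is the graph obtained from $G$ by deleting the vertex $v$ and all edges incident with it. *)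

theory Defs
  imports "Graph_Theory.Graph_Theory"
begin

text \<open>
  A finite simple undirected graph is a loop-free symmetric digraph without parallel arcs:
  \<^locale>\<open>pair_graph\<close>, or its image under \<^const>\<open>with_proj\<close>, which satisfies \<^locale>\<open>graph\<close>.
  An edge is a pair of opposite arcs, so \<^const>\<open>out_degree\<close> is the degree of a vertex.
  These locales allow the empty vertex set; it has to be excluded separately.
\<close>

definition degree_monotone_path :: "('a, 'b) pre_digraph \<Rightarrow> 'a list \<Rightarrow> bool" where
  "degree_monotone_path G p \<longleftrightarrow> vpath p G \<and>
     (sorted_wrt (\<le>) (map (out_degree G) p) \<or> sorted_wrt (\<ge>) (map (out_degree G) p))"

text \<open>
  Lengths are numbers of vertices, unlike \<^const>\<open>vwalk_length\<close>, which counts edges.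
\<close>

definition mp :: "('a, 'b) pre_digraph \<Rightarrow> nat" where
  "mp G = Max {length p | p. degree_monotone_path G p}"

text \<open>
  The new vertex \<open>v\<close> is joined to exactly the vertices in \<open>S\<close>. Only meaningful for
  \<open>v\<close> outside and \<open>S\<close> inside the vertex set of \<open>G\<close>.
\<close>

definition add_joined_vert :: "'a pair_pre_digraph \<Rightarrow> 'a \<Rightarrow> 'a set \<Rightarrow> 'a pair_pre_digraph" where
  "add_joined_vert G v S =
     \<lparr> pverts = insert v (pverts G), parcs = parcs G \<union> {v} \<times> S \<union> S \<times> {v} \<rparr>"

lemma pair_graph_add_joined_vert:
  assumes "pair_graph G" "v \<notin> pverts G" "S \<subseteq> pverts G"
  shows "pair_graph (add_joined_vert G v S)"
proof -
  interpret pair_graph G by fact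
  have "finite S" using assms(3) pair_finite_verts by (rule finite_subset)
  moreover have "symmetric (with_proj (add_joined_vert G v S))"
    using arcs_symmetric by (auto simp: symmetric_def add_joined_vert_def intro!: symI)
  ultimately show ?thesis
    using assms(2,3) pair_finite_verts pair_finite_arcs
    by unfold_locales
      (auto simp: add_joined_vert_def dest: in_arcsD1 in_arcsD2 no_loops')
qed

text \<open>The maximum in \<^const>\<open>mp\<close> ranges over a finite non-empty set.\<close>

lemma finite_degree_monotone_path_lengths:
  assumes "finite (verts G)"
  shows "finite {length p | p. degree_monotone_path G p}"
proof (rule finite_subset)
  show "{length p | p. degree_monotone_path G p} \<subseteq> {..card (verts G)}"
  proof clarsimp
    fix p assume "degree_monotone_path G p"
    then have "distinct p" "set p \<subseteq> verts G"
      by (auto simp: degree_monotone_path_def vpath_def vwalk_def)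
    then show "length p \<le> card (verts G)"
      using assms by (metis card_mono distinct_card)
  qed
qed simp

lemma degree_monotone_path_singleton:
  assumes "v \<in> verts G"
  shows "degree_monotone_path G [v]"
  using assms by (auto simp: degree_monotone_path_def vpath_def vwalk_def)

end

theory Submission
  imports Defs
begin

text \<open>The vertices of a path are distinct, so in a finite graph no degree monotone path has
  more vertices than the graph (\<open>mp_le_card_verts\<close>); both upper bounds count the
  vertices of the new graph. The lower bounds need only very short paths, on which monotonicity is
  automatic: a single vertex gives 1 (\<open>one_le_mp\<close>), and an edge, such as one joining
  the new vertex to \<open>G\<close>, gives 2 (\<open>degree_monotone_path_arc\<close>).\<close>

lemma length_le_mp:
  assumes "finite (verts G)" "degree_monotone_path G p"
  shows "length p \<le> mp G"
  unfolding mp_def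
  using assms by (intro Max_ge finite_degree_monotone_path_lengths) auto

lemma mp_le_card_verts:
  assumes "finite (verts G)" "verts G \<noteq> {}"
  shows "mp G \<le> card (verts G)"
  unfolding mp_def
proof (rule Max.boundedI)
  show "finite {length p | p. degree_monotone_path G p}"
    using assms(1) by (rule finite_degree_monotone_path_lengths)
  \<comment> \<open>\<open>Max\<close> is meaningful only on a non-empty set; a one-vertex path
    supplies an element.\<close>
  show "{length p | p. degree_monotone_path G p} \<noteq> {}"
    using assms(2) degree_monotone_path_singleton by fastforce
next
  fix n assume "n \<in> {length p | p. degree_monotone_path G p}"
  then obtain p where "n = length p" "distinct p" "set p \<subseteq> verts G"
    by (auto simp: degree_monotone_path_def vpath_def vwalk_def)
  then show "n \<le> card (verts G)"
    using assms(1) by (metis card_mono distinct_card)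
qed

lemma one_le_mp:
  assumes "finite (verts G)" "verts G \<noteq> {}"
  shows "1 \<le> mp G"
  using assms length_le_mp degree_monotone_path_singleton by fastforce

text \<open>Two degrees are always comparable, so a path on two vertices is either non-decreasing or
  non-increasing, whatever the degrees are.\<close>

lemma degree_monotone_path_arc:
  assumes "u \<in> verts G" "w \<in> verts G" "u \<noteq> w" "(u, w) \<in> arcs_ends G"
  shows "degree_monotone_path G [u, w]"
  using assms by (auto simp: degree_monotone_path_def vpath_def vwalk_def)

theorem proposition3p1:
  fixes G :: "'a pair_pre_digraph"
  assumes "pair_graph G" and "pverts G \<noteq> {}"
  shows "(\<forall>v S. v \<notin> pverts G \<and> S \<subseteq> pverts G \<and> S \<noteq> {} \<longrightarrow>
            2 \<le> mp (with_proj (add_joined_vert G v S)) \<and>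
            mp (with_proj (add_joined_vert G v S)) \<le> card (pverts G) + 1) \<and>
         (\<forall>v. card (pverts G) \<ge> 2 \<and> v \<in> pverts G \<longrightarrow>
            1 \<le> mp (pre_digraph.del_vert (with_proj G) v) \<and>
            mp (pre_digraph.del_vert (with_proj G) v) \<le> card (pverts G) - 1)"
proof (intro conjI allI impI; elim conjE)
  interpret pair_graph G by fact
  have fin: "finite (pverts G)" by (rule pair_finite_verts)
  {
    fix v S assume v: "v \<notin> pverts G" and S: "S \<subseteq> pverts G" "S \<noteq> {}"
    let ?H = "with_proj (add_joined_vert G v S)"
    have verts: "verts ?H = insert v (pverts G)"
      by (simp add: add_joined_vert_def)
    obtain s where s: "s \<in> S" using S(2) by blast
    \<comment> \<open>Any neighbour \<open>s\<close> of the new vertex will do: the arc from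
      \<open>v\<close> to \<open>s\<close> lies in the added part
      \<open>{v} \<times> S\<close>.\<close>
    then have "degree_monotone_path ?H [v, s]"
      using v S(1) by (intro degree_monotone_path_arc)
        (auto simp: add_joined_vert_def arcs_ends_def arc_to_ends_def)
    then show "2 \<le> mp ?H"
      using length_le_mp[of ?H "[v, s]"] fin verts by simp
    show "mp ?H \<le> card (pverts G) + 1"
      using mp_le_card_verts[of ?H] fin verts v by simp
  }
  {
    fix v assume card: "2 \<le> card (pverts G)" and v: "v \<in> pverts G"
    let ?H = "pre_digraph.del_vert (with_proj G) v"
    have verts: "verts ?H = pverts G - {v}"
      by (simp add: pre_digraph.verts_del_vert)
    have card_H: "card (verts ?H) = card (pverts G) - 1"
      using v verts by simp
    \<comment> \<open>Having at least two vertices in \<open>G\<close> leaves one after the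
      deletion, so \<open>mp ?H\<close> is the maximum of a non-empty set.\<close>
    then have ne: "verts ?H \<noteq> {}" using card by (metis card.empty diff_is_0_eq not_less_eq_eq numeral_2_eq_2 One_nat_def)
    have finH: "finite (verts ?H)" using fin verts by simp
    show "1 \<le> mp ?H" using finH ne by (rule one_le_mp)
    show "mp ?H \<le> card (pverts G) - 1"
      using mp_le_card_verts[OF finH ne] card_H by simp
  }
qed

end
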